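(* Let $\lambda>0$. For $0<p<(2+\sqrt3)/4$ let $X_{\lambda,p}=N_+-N_--\lambda(2p-1)$, where $N_+\sim\operatorname{Poisson}(\lambda p)$ and $N_-\sim\operatorname{Poisson}(\lambda(1-p))$ are independent, and let $t_p\in(0,\infty)$ be any global maximizer of $\Psi_p$ on $(0,\infty)$. Write $L=\log(1/p)$. Then, as $p\downarrow0$, $$t_p=L+3\log L-\log2+o(1)$$ and $$c_+(X_{\lambda,p})\sim\frac1L .$$ The conclusion holds for every choice of global maximizers $t_p$.
   Context: For $p\in[0,1]$ and $t>0$ define $$M_p(t)=\frac{2}{t^2}\bigl\{\cosh t-1+(2p-1)(\sinh t-t)\bigr\},\qquad \Psi_p(t)=\frac{1-M_p(t)^{-1}}{t}.$$ For $0<p<(2+\sqrt3)/4$ the supremum of $\Psi_p$ over $(0,\infty)$ is attained at some positive finite argument. The variance of $X_{\lambda,p}$ is $V=\lambda$. For a centered random variable $X$ with variance $V>0$ and $K_X(t)=\log\mathbb{E}e^{tX}$, $c_+(X)$ is the infimum of all $c\ge0$ such that $K_X(t)\le\frac{Vt^2}{2(1-ct)}$ for every $0\le t<1/c$ (with $1/0=\infty$). *)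

theory Defs
  imports "HOL-Probability.Probability" "HOL-Library.Landau_Symbols"
begin

unbundle asymp_equiv_syntax

text \<open>The cumulant generating function is extended-valued: \<open>exp (t * X)\<close> need not be integrable,
  and the Bochner integral would then be \<open>0\<close> instead of \<open>\<infinity>\<close>.\<close>

definition cgf :: "'a measure \<Rightarrow> ('a \<Rightarrow> real) \<Rightarrow> real \<Rightarrow> ereal" where
  "cgf M X t =
     (if integrable M (\<lambda>\<omega>. exp (t * X \<omega>))
      then ereal (ln (prob_space.expectation M (\<lambda>\<omega>. exp (t * X \<omega>)))) else \<infinity>)"

text \<open>Meant for centered \<open>X\<close> of positive variance. The disjunct \<open>c = 0\<close> encodes \<open>1/0 = \<infinity>\<close>; the
  infimum is taken in the extended reals, so it is \<open>\<infinity>\<close> when no \<open>c\<close> is admissible.\<close>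

definition c_plus :: "'a measure \<Rightarrow> ('a \<Rightarrow> real) \<Rightarrow> ereal" where
  "c_plus M X = Inf {ereal c | c. 0 \<le> c \<and>
     (\<forall>t. 0 \<le> t \<and> (c = 0 \<or> t < 1 / c) \<longrightarrow>
        cgf M X t \<le> ereal (prob_space.variance M X * t\<^sup>2 / (2 * (1 - c * t))))}"

definition M_fun :: "real \<Rightarrow> real \<Rightarrow> real" where
  "M_fun p t = 2 / t\<^sup>2 * (cosh t - 1 + (2 * p - 1) * (sinh t - t))"

definition Psi :: "real \<Rightarrow> real \<Rightarrow> real" where
  "Psi p t = (1 - inverse (M_fun p t)) / t"

end

theory Submission
  imports Defs "HOL-Real_Asymp.Real_Asymp"
begin

text \<open>Writing \<open>K(t) = lam * Q(t)\<close> for the cumulant generating function, the admissibility of \<open>c\<close>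
  amounts to \<open>Psi p \<le> c\<close> on \<open>(0, \<infinity>)\<close>, where \<open>Psi p t = 1 / t - t / (2 * Q(t))\<close>. With
  \<open>p = exp (- L)\<close> one has \<open>Q(t) = exp (- t) - 1 + t + p * (exp t - exp (- t) - 2 * t)\<close>, and
  \<open>Psi p \<le> 0\<close> until \<open>p * exp t\<close> is at least of order \<open>L\<^sup>2\<close>. The centre
  \<open>T = L + 3 * ln L - ln 2\<close> is chosen so that \<open>2 * p * exp T = L ^ 3\<close>; near it
  \<open>Psi p (T + x) = 1 / T - (x + exp (- x) + o(1)) / L\<^sup>2\<close>, and \<open>x + exp (- x)\<close> has its strict
  minimum at \<open>0\<close>. Cruder estimates exclude all other \<open>t\<close>, so every maximizer lies within
  \<open>o(1)\<close> of \<open>T\<close>.\<close>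

subsection \<open>Moments of the Poisson distribution\<close>

text \<open>Nonnegativity makes convergence of the weighted series absolute, so it gives
  integrability and value together. With \<open>exp (- \<mu>)\<close> pulled out, every Poisson
  moment becomes a power series identity.\<close>

lemma has_bochner_integral_poisson_pmf:
  fixes f :: "nat \<Rightarrow> real"
  assumes "\<mu> > 0" "\<And>k. f k \<ge> 0" "(\<lambda>k. \<mu> ^ k / fact k * f k) sums s"
  shows "has_bochner_integral (measure_pmf (poisson_pmf \<mu>)) f (s * exp (- \<mu>))"
proof -
  have sums: "(\<lambda>k. pmf (poisson_pmf \<mu>) k *\<^sub>R f k) sums (s * exp (- \<mu>))"
    using sums_mult2[OF assms(3), of "exp (- \<mu>)"] assms(1) by (simp add: mult_ac)
  have "integrable (count_space UNIV) (\<lambda>k. pmf (poisson_pmf \<mu>) k *\<^sub>R f k)"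
    unfolding integrable_count_space_nat_iff
    using sums_summable[OF sums] assms(1,2) by (simp add: abs_mult)
  moreover from this have "(\<integral>k. pmf (poisson_pmf \<mu>) k *\<^sub>R f k \<partial>count_space UNIV) = s * exp (- \<mu>)"
    using sums sums_integral_count_space_nat sums_unique2 by blast
  ultimately show ?thesis
    unfolding measure_pmf_eq_density
    by (intro has_bochner_integral_density) (auto simp: has_bochner_integral_iff)
qed

lemma sums_exp_divide_fact: "(\<lambda>k. x ^ k / fact k) sums exp (x :: real)"
  using exp_converges[of x] by (simp add: divide_inverse mult.commute)

lemma poisson_exp_moment:
  assumes "\<mu> > 0"
  shows "has_bochner_integral (measure_pmf (poisson_pmf \<mu>)) (\<lambda>k. exp (t * real k))
           (exp (\<mu> * (exp t - 1)))"
proof -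
  have "(\<lambda>k. \<mu> ^ k / fact k * exp (t * real k)) sums exp (\<mu> * exp t)"
    using sums_exp_divide_fact[of "\<mu> * exp t"]
    by (simp add: power_mult_distrib exp_of_nat_mult mult.commute[of t])
  from has_bochner_integral_poisson_pmf[OF assms _ this]
  show ?thesis by (simp add: exp_add[symmetric] algebra_simps)
qed

text \<open>The size-biasing identity E[N g(N)] = \<mu> E[g(N + 1)]: the factor \<open>k\<close>
  cancels against \<open>fact k\<close>, and the term at \<open>k = 0\<close> vanishes. It yields
  both moments from the exponential series.\<close>

lemma sums_poisson_size_bias:
  fixes g :: "nat \<Rightarrow> real"
  assumes "(\<lambda>k. \<mu> ^ k / fact k * g (Suc k)) sums s"
  shows "(\<lambda>k. \<mu> ^ k / fact k * (real k * g k)) sums (\<mu> * s)"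
proof -
  have "(\<lambda>k. \<mu> ^ Suc k / fact (Suc k) * (real (Suc k) * g (Suc k))) sums (\<mu> * s)"
    using sums_mult[OF assms, of \<mu>] by (simp add: divide_simps mult_ac del: of_nat_Suc)
  then show ?thesis
    using sums_Suc_iff[of "\<lambda>k. \<mu> ^ k / fact k * (real k * g k)" "\<mu> * s"] by simp
qed

lemma sums_poisson_first_moment: "(\<lambda>k. \<mu> ^ k / fact k * real k) sums (\<mu> * exp \<mu>)"
  using sums_poisson_size_bias[of \<mu> "\<lambda>_. 1" "exp \<mu>"] sums_exp_divide_fact[of \<mu>] by simp

lemma poisson_first_moment:
  assumes "\<mu> > 0"
  shows "has_bochner_integral (measure_pmf (poisson_pmf \<mu>)) real \<mu>"
  using has_bochner_integral_poisson_pmf[OF assms _ sums_poisson_first_moment]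
  by (simp add: mult.assoc exp_minus_inverse)

lemma poisson_second_moment:
  assumes "\<mu> > 0"
  shows "has_bochner_integral (measure_pmf (poisson_pmf \<mu>)) (\<lambda>k. (real k)\<^sup>2) (\<mu>\<^sup>2 + \<mu>)"
proof -
  have "(\<lambda>k. \<mu> ^ k / fact k * real (Suc k)) sums (\<mu> * exp \<mu> + exp \<mu>)"
    using sums_add[OF sums_poisson_first_moment[of \<mu>] sums_exp_divide_fact[of \<mu>]]
    by (simp add: distrib_left add.commute)
  from sums_poisson_size_bias[of \<mu> real, OF this]
  have "(\<lambda>k. \<mu> ^ k / fact k * (real k)\<^sup>2) sums (\<mu> * (\<mu> * exp \<mu> + exp \<mu>))"
    by (simp add: power2_eq_square)
  from has_bochner_integral_poisson_pmf[OF assms _ this]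
  show ?thesis by (simp add: exp_minus_inverse power2_eq_square mult.assoc distrib_right distrib_left)
qed

subsection \<open>The compensated difference of two Poisson variables\<close>

lemma (in prob_space) variance_diff_indep:
  fixes Y Z :: "'a \<Rightarrow> real"
  assumes indep: "indep_var borel Y borel Z"
    and Y: "integrable M Y" "integrable M (\<lambda>\<omega>. (Y \<omega>)\<^sup>2)"
    and Z: "integrable M Z" "integrable M (\<lambda>\<omega>. (Z \<omega>)\<^sup>2)"
  shows "variance (\<lambda>\<omega>. Y \<omega> - Z \<omega>) = variance Y + variance Z"
proof -
  have YZ: "integrable M (\<lambda>\<omega>. Y \<omega> * Z \<omega>)"
    "expectation (\<lambda>\<omega>. Y \<omega> * Z \<omega>) = expectation Y * expectation Z"
    using indep_var_integrable[OF indep Y(1) Z(1)] indep_var_lebesgue_integral[OF indep Y(1) Z(1)]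
    by auto
  have sq: "(\<lambda>\<omega>. (Y \<omega> - Z \<omega>)\<^sup>2) = (\<lambda>\<omega>. (Y \<omega>)\<^sup>2 - 2 * (Y \<omega> * Z \<omega>) + (Z \<omega>)\<^sup>2)"
    by (auto simp: power2_eq_square algebra_simps)
  have "integrable M (\<lambda>\<omega>. (Y \<omega> - Z \<omega>)\<^sup>2)"
    unfolding sq by (intro Bochner_Integration.integrable_add Bochner_Integration.integrable_diff
        integrable_mult_right Y Z YZ)
  moreover have "expectation (\<lambda>\<omega>. (Y \<omega> - Z \<omega>)\<^sup>2) =
      expectation (\<lambda>\<omega>. (Y \<omega>)\<^sup>2) - 2 * (expectation Y * expectation Z) + expectation (\<lambda>\<omega>. (Z \<omega>)\<^sup>2)"
    unfolding sq using Y Z YZ by simp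
  ultimately have "variance (\<lambda>\<omega>. Y \<omega> - Z \<omega>) =
      expectation (\<lambda>\<omega>. (Y \<omega>)\<^sup>2) - 2 * (expectation Y * expectation Z) +
      expectation (\<lambda>\<omega>. (Z \<omega>)\<^sup>2) - (expectation Y - expectation Z)\<^sup>2"
    using Y Z by (subst variance_eq) auto
  also have "\<dots> = variance Y + variance Z"
    unfolding variance_eq[OF Y] variance_eq[OF Z] by (simp add: power2_eq_square algebra_simps)
  finally show ?thesis .
qed

text \<open>This is the \<open>Q\<close> of the overview; for \<open>t > 0\<close> it equals
  \<open>M_fun p t * t\<^sup>2 / 2\<close>, which links \<open>Psi\<close> to the cumulant
  generating function.\<close>

definition cgf_poisson_diff :: "real \<Rightarrow> real \<Rightarrow> real" where
  "cgf_poisson_diff p t = cosh t - 1 + (2 * p - 1) * (sinh t - t)"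

lemma cgf_poisson_diff_exp:
  "cgf_poisson_diff p t = exp (- t) - 1 + t + p * (exp t - exp (- t) - 2 * t)"
  by (simp add: cgf_poisson_diff_def cosh_def sinh_def field_simps)

lemma has_bochner_integral_distr_eq:
  fixes f :: "nat \<Rightarrow> real"
  assumes "N \<in> measurable M (count_space UNIV)"
    and "distr M (count_space UNIV) N = D" "has_bochner_integral D f s"
  shows "has_bochner_integral M (\<lambda>\<omega>. f (N \<omega>)) s"
  using assms by (auto simp: has_bochner_integral_iff integrable_distr_eq integral_distr)

text \<open>Independence factors the exponential moment into two Poisson ones, and the variances
  add. The condition \<open>p < 1\<close> keeps both rates positive. These two facts are all that
  \<open>c_plus\<close> sees of \<open>X\<close>.\<close>

lemma
  fixes N1 N2 :: "'a \<Rightarrow> nat"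
  assumes "prob_space M" and lam: "lam > 0" and p: "0 < p" "p < 1"
    and indep: "prob_space.indep_var M (count_space UNIV) N1 (count_space UNIV) N2"
    and N1: "distr M (count_space UNIV) N1 = measure_pmf (poisson_pmf (lam * p))"
    and N2: "distr M (count_space UNIV) N2 = measure_pmf (poisson_pmf (lam * (1 - p)))"
    and X: "\<And>\<omega>. X \<omega> = real (N1 \<omega>) - real (N2 \<omega>) - lam * (2 * p - 1)"
  shows cgf_compensated_poisson_diff: "cgf M X t = ereal (lam * cgf_poisson_diff p t)"
    and variance_compensated_poisson_diff: "prob_space.variance M X = lam"
proof -
  interpret prob_space M by fact
  have pos: "lam * p > 0" "lam * (1 - p) > 0" using lam p by auto
  have meas: "N1 \<in> measurable M (count_space UNIV)" "N2 \<in> measurable M (count_space UNIV)"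
    using indep_var_rv1[OF indep] indep_var_rv2[OF indep] by auto
  note I1 = has_bochner_integral_distr_eq[OF meas(1) N1]
  note I2 = has_bochner_integral_distr_eq[OF meas(2) N2]
  have indep': "indep_var borel (\<lambda>\<omega>. f (N1 \<omega>)) borel (\<lambda>\<omega>. g (N2 \<omega>))" for f g :: "nat \<Rightarrow> real"
    using indep_var_compose[OF indep, of f borel g borel] by (simp add: comp_def)

  define E1 where "E1 = exp (lam * p * (exp t - 1))"
  define E2 where "E2 = exp (lam * (1 - p) * (exp (- t) - 1))"
  have e1: "has_bochner_integral M (\<lambda>\<omega>. exp (t * real (N1 \<omega>))) E1"
    unfolding E1_def using I1[OF poisson_exp_moment[OF pos(1)], of t] .
  have e2: "has_bochner_integral M (\<lambda>\<omega>. exp (- t * real (N2 \<omega>))) E2"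
    unfolding E2_def using I2[OF poisson_exp_moment[OF pos(2)], of "- t"] .
  have int: "integrable M (\<lambda>\<omega>. exp (t * real (N1 \<omega>)))" "integrable M (\<lambda>\<omega>. exp (- t * real (N2 \<omega>)))"
    using e1 e2 by (auto simp: has_bochner_integral_iff)
  note ind = indep'[of "\<lambda>k. exp (t * real k)" "\<lambda>k. exp (- t * real k)"]
  have "has_bochner_integral M (\<lambda>\<omega>. exp (t * real (N1 \<omega>)) * exp (- t * real (N2 \<omega>))) (E1 * E2)"
    using indep_var_integrable[OF ind int] indep_var_lebesgue_integral[OF ind int] e1 e2
    by (simp add: has_bochner_integral_iff)
  from has_bochner_integral_mult_right[OF this, of "exp (- t * (lam * (2 * p - 1)))"]
  have "has_bochner_integral M (\<lambda>\<omega>. exp (t * X \<omega>)) (exp (- t * (lam * (2 * p - 1))) * (E1 * E2))"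
    by (simp add: X exp_add[symmetric] algebra_simps)
  moreover have "exp (- t * (lam * (2 * p - 1))) * (E1 * E2) = exp (lam * cgf_poisson_diff p t)"
    unfolding cgf_poisson_diff_exp E1_def E2_def exp_add[symmetric]
    by (rule arg_cong[where f = exp]) (simp add: algebra_simps)
  ultimately have "has_bochner_integral M (\<lambda>\<omega>. exp (t * X \<omega>)) (exp (lam * cgf_poisson_diff p t))"
    by simp
  then show "cgf M X t = ereal (lam * cgf_poisson_diff p t)"
    by (simp add: cgf_def has_bochner_integral_iff)

  have m1: "has_bochner_integral M (\<lambda>\<omega>. real (N1 \<omega>)) (lam * p)"
    "has_bochner_integral M (\<lambda>\<omega>. (real (N1 \<omega>))\<^sup>2) ((lam * p)\<^sup>2 + lam * p)"
    using I1[OF poisson_first_moment[OF pos(1)]] I1[OF poisson_second_moment[OF pos(1)]] by auto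
  have m2: "has_bochner_integral M (\<lambda>\<omega>. real (N2 \<omega>)) (lam * (1 - p))"
    "has_bochner_integral M (\<lambda>\<omega>. (real (N2 \<omega>))\<^sup>2) ((lam * (1 - p))\<^sup>2 + lam * (1 - p))"
    using I2[OF poisson_first_moment[OF pos(2)]] I2[OF poisson_second_moment[OF pos(2)]] by auto
  have "expectation (\<lambda>\<omega>. real (N1 \<omega>) - real (N2 \<omega>)) = lam * (2 * p - 1)"
    using m1 m2 by (simp add: has_bochner_integral_iff algebra_simps)
  moreover from this have "expectation X = 0"
    unfolding X[abs_def] using m1 m2
    by (subst Bochner_Integration.integral_diff) (auto simp: has_bochner_integral_iff prob_space)
  \<comment> \<open>The compensator is exactly the mean of the difference, so both variances
    integrate the same function.\<close>
  ultimately have "variance X = variance (\<lambda>\<omega>. real (N1 \<omega>) - real (N2 \<omega>))"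
    by (simp add: X)
  also have "\<dots> = variance (\<lambda>\<omega>. real (N1 \<omega>)) + variance (\<lambda>\<omega>. real (N2 \<omega>))"
    using m1 m2 by (intro variance_diff_indep indep') (auto simp: has_bochner_integral_iff)
  also have "\<dots> = lam * p + lam * (1 - p)"
    using m1 m2 by (subst (1 2) variance_eq) (auto simp: has_bochner_integral_iff)
  finally show "variance X = lam" by (simp add: algebra_simps)
qed

subsection \<open>The parameter \<open>c_plus\<close> as a supremum\<close>

lemma less_sinh_real: "x < sinh x" if "x > 0" for x :: real
proof -
  have "sinh 0 - 0 < sinh x - x"
  proof (rule DERIV_pos_imp_increasing_open[OF that])
    fix y :: real assume y: "0 < y" "y < x"
    have "cosh 0 < cosh y" using y by (simp only: cosh_real_nonneg_less_iff)
    then show "\<exists>d. ((\<lambda>x. sinh x - x) has_real_derivative d) (at y) \<and> 0 < d"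
      by (intro exI[of _ "cosh y - 1"]) (auto intro!: derivative_eq_intros)
  qed (auto intro!: continuous_intros)
  then show ?thesis by simp
qed

lemma cgf_poisson_diff_pos:
  assumes "t > 0" "p > 0"
  shows "cgf_poisson_diff p t > 0"
proof -
  have "exp (- t) - 1 + t \<ge> 0" using exp_ge_add_one_self[of "- t"] by linarith
  moreover have "p * (exp t - exp (- t) - 2 * t) > 0"
    using less_sinh_real[OF assms(1)] assms(2) by (simp add: sinh_def)
  ultimately show ?thesis unfolding cgf_poisson_diff_exp by linarith
qed

lemma Psi_eq:
  assumes "t > 0"
  shows "Psi p t = 1 / t - t / (2 * cgf_poisson_diff p t)"
  using assms
  by (simp add: Psi_def M_fun_def cgf_poisson_diff_def[symmetric] diff_divide_distrib
      power2_eq_square)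

text \<open>Drops the positive subtracted term. This crude bound settles both
  \<open>t \<ge> 1 / c\<close> and all \<open>t\<close> far to the right of the centre.\<close>

lemma Psi_less: "t > 0 \<Longrightarrow> p > 0 \<Longrightarrow> Psi p t < 1 / t"
  using cgf_poisson_diff_pos[of t p] by (simp add: Psi_eq)

text \<open>Bridge between \<open>Psi\<close> and the inequality defining \<open>c_plus\<close>:
  both sides clear to the same polynomial inequality, since \<open>c * t < 1\<close> and positivity
  of \<open>cgf_poisson_diff\<close> fix the signs of the denominators.\<close>

lemma Psi_le_iff:
  assumes "t > 0" "p > 0" "c * t < 1"
  shows "Psi p t \<le> c \<longleftrightarrow> cgf_poisson_diff p t \<le> t\<^sup>2 / (2 * (1 - c * t))"
proof -
  let ?Q = "cgf_poisson_diff p t"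
  have Q: "?Q > 0" using cgf_poisson_diff_pos assms by blast
  have "Psi p t \<le> c \<longleftrightarrow> 2 * ?Q \<le> t * t + c * (2 * t * ?Q)"
    using Q assms by (simp add: Psi_eq field_simps)
  also have "\<dots> \<longleftrightarrow> ?Q * (2 * (1 - c * t)) \<le> t\<^sup>2"
    by (simp add: power2_eq_square algebra_simps)
  also have "\<dots> \<longleftrightarrow> ?Q \<le> t\<^sup>2 / (2 * (1 - c * t))"
    using assms by (simp add: pos_le_divide_eq)
  finally show ?thesis .
qed

text \<open>For \<open>t \<ge> 1 / c\<close> the bound \<open>Psi p t \<le> c\<close> is automatic, so the constraint
  \<open>t < 1 / c\<close> in the definition of \<open>c_plus\<close> can be dropped.\<close>

lemma c_plus_eq_Inf_Psi:
  assumes "lam > 0" "p > 0"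
    and cgf: "\<And>t. cgf M X t = ereal (lam * cgf_poisson_diff p t)"
    and var: "prob_space.variance M X = lam"
  shows "c_plus M X = Inf {ereal c | c. 0 \<le> c \<and> (\<forall>t > 0. Psi p t \<le> c)}"
proof -
  have "(\<forall>t. 0 \<le> t \<and> (c = 0 \<or> t < 1 / c) \<longrightarrow>
           cgf M X t \<le> ereal (prob_space.variance M X * t\<^sup>2 / (2 * (1 - c * t)))) \<longleftrightarrow>
        (\<forall>t > 0. Psi p t \<le> c)" (is "?L \<longleftrightarrow> ?R") if c: "0 \<le> c" for c :: real
  proof -
    \<comment> \<open>Since \<open>1 / 0 = 0\<close> in HOL, the product form is what treats
      \<open>c = 0\<close> and \<open>c > 0\<close> uniformly.\<close>
    have dom: "c = 0 \<or> t < 1 / c \<longleftrightarrow> c * t < 1" for t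
      using c by (cases "c = 0") (auto simp: field_simps)
    have "?L \<longleftrightarrow> (\<forall>t. 0 \<le> t \<and> c * t < 1 \<longrightarrow> cgf_poisson_diff p t \<le> t\<^sup>2 / (2 * (1 - c * t)))"
      unfolding dom cgf var using assms(1)
      by (simp add: times_divide_eq_right[symmetric] del: times_divide_eq_right)
    also have "\<dots> \<longleftrightarrow> (\<forall>t > 0. c * t < 1 \<longrightarrow> cgf_poisson_diff p t \<le> t\<^sup>2 / (2 * (1 - c * t)))"
    proof -
      \<comment> \<open>At \<open>t = 0\<close> both sides vanish, so only positive \<open>t\<close>
        carry a constraint.\<close>
      have "cgf_poisson_diff p 0 = 0" by (simp add: cgf_poisson_diff_def)
      then show ?thesis by (metis (no_types) order_le_less order_refl power_zero_numeral div_0)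
    qed
    also have "\<dots> \<longleftrightarrow> (\<forall>t > 0. c * t < 1 \<longrightarrow> Psi p t \<le> c)"
      using Psi_le_iff assms(2) by blast
    also have "\<dots> \<longleftrightarrow> ?R"
    proof -
      have "Psi p t \<le> c" if "t > 0" "\<not> c * t < 1" for t
      proof -
        have "1 / t \<le> c" using that by (simp add: field_simps)
        then show ?thesis using Psi_less[of t p] that assms(2) by linarith
      qed
      then show ?thesis by blast
    qed
    finally show ?thesis .
  qed
  then have "{ereal c | c. 0 \<le> c \<and> (\<forall>t. 0 \<le> t \<and> (c = 0 \<or> t < 1 / c) \<longrightarrow>
           cgf M X t \<le> ereal (prob_space.variance M X * t\<^sup>2 / (2 * (1 - c * t))))} =
        {ereal c | c. 0 \<le> c \<and> (\<forall>t > 0. Psi p t \<le> c)}"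
    by blast
  then show ?thesis by (simp only: c_plus_def)
qed

lemma real_of_ereal_c_plus_bounds:
  assumes "lam > 0" "p > 0"
    and "\<And>t. cgf M X t = ereal (lam * cgf_poisson_diff p t)"
    and "prob_space.variance M X = lam"
    and "s > 0" "0 \<le> c" "\<And>t. t > 0 \<Longrightarrow> Psi p t \<le> c"
  shows "Psi p s \<le> real_of_ereal (c_plus M X)" "real_of_ereal (c_plus M X) \<le> c"
proof -
  have up: "c_plus M X \<le> ereal c"
    unfolding c_plus_eq_Inf_Psi[OF assms(1-4)] using assms(6,7) by (intro Inf_lower) auto
  have low: "ereal (Psi p s) \<le> c_plus M X"
    unfolding c_plus_eq_Inf_Psi[OF assms(1-4)] using assms(5) by (intro Inf_greatest) auto
  \<comment> \<open>Finiteness comes first, because \<open>real_of_ereal\<close> sends infinite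
    values to 0.\<close>
  obtain r where r: "c_plus M X = ereal r"
    using up low by (cases "c_plus M X") auto
  show "Psi p s \<le> real_of_ereal (c_plus M X)" "real_of_ereal (c_plus M X) \<le> c"
    using up low by (simp_all add: r)
qed

subsection \<open>Upper bounds for \<open>Psi\<close>\<close>

lemma cgf_poisson_diff_le:
  assumes "t \<ge> 0" "p \<ge> 0"
  shows "cgf_poisson_diff p t \<le> t + p * exp t"
proof -
  have "exp (- t) \<le> 1" using assms by simp
  moreover have "p * (exp t - exp (- t) - 2 * t) \<le> p * exp t"
    using assms exp_gt_zero[of "- t"] by (intro mult_left_mono) linarith+
  ultimately show ?thesis unfolding cgf_poisson_diff_exp by linarith
qed

text \<open>\<open>Psi\<close> increases with \<open>cgf_poisson_diff\<close>, so an upper bound for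
  the latter suffices; only the competing terms \<open>t\<close> and \<open>p * exp t\<close>
  survive.\<close>

lemma Psi_le:
  assumes "t > 0" "p > 0"
  shows "Psi p t \<le> 1 / t - t / (2 * t + 2 * p * exp t)"
proof -
  have "t / (2 * t + 2 * p * exp t) \<le> t / (2 * cgf_poisson_diff p t)"
    using cgf_poisson_diff_le[of t p] cgf_poisson_diff_pos[of t p] assms
    by (intro divide_left_mono mult_pos_pos) (auto intro: add_pos_pos)
  then show ?thesis by (simp add: Psi_eq[OF assms(1)])
qed

lemma Psi_nonpos_iff:
  assumes "t > 0" "p > 0"
  shows "Psi p t \<le> 0 \<longleftrightarrow> 2 * cgf_poisson_diff p t \<le> t\<^sup>2"
  using Psi_le_iff[of t p 0] assms by auto

text \<open>Handles small \<open>t\<close>, where the bound \<open>t + p * exp t\<close> is too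
  crude to compare with \<open>t\<^sup>2 / 2\<close>. By Taylor expansion to third order,
  \<open>exp (- t) - 1 + t\<close> falls short of \<open>t\<^sup>2 / 2\<close> by at least
  \<open>exp (- t) * t ^ 3 / 6\<close>, and the hypothesis keeps the \<open>p\<close> term within
  that deficit.\<close>

lemma Psi_nonpos_of_small:
  assumes "t > 0" "p > 0" "2 * p * exp t \<le> exp (- t)"
  shows "Psi p t \<le> 0"
proof -
  obtain u where u: "\<bar>u\<bar> < \<bar>- t\<bar>" "exp (- t) = (\<Sum>m<3. (- t) ^ m / fact m) + exp u / fact 3 * (- t) ^ 3"
    using Maclaurin_exp_lt[of "- t" 3] assms(1) by auto
  obtain v where v: "\<bar>v\<bar> < \<bar>t\<bar>" "exp t = (\<Sum>m<3. t ^ m / fact m) + exp v / fact 3 * t ^ 3"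
    using Maclaurin_exp_lt[of t 3] assms(1) by auto
  have u': "exp (- t) = 1 - t + t\<^sup>2 / 2 - exp u * (t ^ 3 / 6)"
    using u(2) by (simp add: numeral_3_eq_3 fact_reduce power2_eq_square field_simps)
  have v': "exp t = 1 + t + t\<^sup>2 / 2 + exp v * (t ^ 3 / 6)"
    using v(2) by (simp add: numeral_3_eq_3 fact_reduce power2_eq_square field_simps)
  have t3: "t ^ 3 / 6 \<ge> 0" using assms by simp
  have ub: "exp u * (t ^ 3 / 6) \<le> exp t * (t ^ 3 / 6)" "exp v * (t ^ 3 / 6) \<le> exp t * (t ^ 3 / 6)"
    "exp (- t) * (t ^ 3 / 6) \<le> exp u * (t ^ 3 / 6)"
    using u(1) v(1) t3 assms(1) by (auto intro!: mult_right_mono)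
  have "exp t - exp (- t) - 2 * t \<le> 2 * (exp t * (t ^ 3 / 6))"
    using u' v' ub by linarith
  then have "2 * p * (exp t - exp (- t) - 2 * t) \<le> 2 * p * (2 * (exp t * (t ^ 3 / 6)))"
    using assms by (intro mult_left_mono) auto
  also have "\<dots> = (2 * p * exp t) * (2 * (t ^ 3 / 6))" by simp
  also have "\<dots> \<le> exp (- t) * (2 * (t ^ 3 / 6))"
    using assms t3 by (intro mult_right_mono) auto
  finally have "2 * p * (exp t - exp (- t) - 2 * t) \<le> 2 * (exp (- t) * (t ^ 3 / 6))" by simp
  \<comment> \<open>\<open>E\<close> stands for \<open>exp (- t)\<close>, \<open>B\<close> for the
    \<open>p\<close> term, \<open>W\<close> for the Taylor remainder and \<open>D\<close> for its
    lower bound; as variables they leave a linear problem.\<close>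
  moreover have "2 * (E - 1 + t + B) \<le> t\<^sup>2"
    if "2 * B \<le> 2 * D" "E = 1 - t + t\<^sup>2 / 2 - W" "D \<le> W" for E B D W :: real
    using that unfolding distrib_left right_diff_distrib by linarith
  ultimately have "2 * cgf_poisson_diff p t \<le> t\<^sup>2"
    using u' ub(3) unfolding cgf_poisson_diff_exp mult.assoc by blast
  then show ?thesis using Psi_nonpos_iff assms by blast
qed

subsection \<open>Location of the maximizers\<close>

definition argmax_approx :: "real \<Rightarrow> real" where
  "argmax_approx L = L + 3 * ln L - ln 2"

text \<open>In the shifted variable \<open>x\<close> this turns \<open>t / (2 * p * exp t)\<close>
  into about \<open>exp (- x) / L\<^sup>2\<close>, the same order as the change
  \<open>- x / L\<^sup>2\<close> of \<open>1 / t\<close>. The balance of the two fixes the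
  centre.\<close>

lemma exp_argmax_approx:
  assumes "L > 0"
  shows "2 * exp (- L) * exp (argmax_approx L + x) = exp x * L ^ 3"
proof -
  have "exp (3 * ln L) = L ^ 3"
    using assms by (metis exp_ln exp_of_nat_mult of_nat_numeral)
  moreover have "exp (- L) * exp (argmax_approx L + x) = exp (3 * ln L) * exp x / exp (ln 2)"
    unfolding exp_add[symmetric] exp_diff[symmetric] by (simp add: argmax_approx_def algebra_simps)
  ultimately show ?thesis by (simp add: mult_ac)
qed

section \<open>Estimates of \<open>Psi\<close> on successive ranges of \<open>t\<close>, for large
  \<open>L\<close>\<close>

lemma eventually_Psi_nonpos:
  "eventually (\<lambda>L. \<forall>t. 0 < t \<and> t \<le> L + ln L \<longrightarrow> Psi (exp (- L)) t \<le> 0) at_top"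
proof -
  have "eventually (\<lambda>L::real. L > 0) at_top"
    "eventually (\<lambda>L::real. 2 * exp (- L / 3) \<le> 1) at_top"
    "eventually (\<lambda>L::real. 4 * L + 2 * ln L \<le> (L / 3)\<^sup>2) at_top"
    by real_asymp+
  then show ?thesis
  proof eventually_elim
    case (elim L)
    show ?case
    proof (intro allI impI, elim conjE)
      fix t assume t: "0 < t" "t \<le> L + ln L"
      show "Psi (exp (- L)) t \<le> 0"
      \<comment> \<open>Below the cut, \<open>2 * p * exp (2 * t)\<close> is small and the Taylor
        argument applies; above it, \<open>t\<^sup>2\<close> is of order at least
        \<open>L\<^sup>2\<close> and beats the linear bound. Any fixed fraction strictly between 0
        and 1/2 would serve.\<close>
      proof (cases "t \<le> L / 3")
        case True
        have "2 * exp (- L) * exp t = 2 * exp (- L + t + t) * exp (- t)"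
          by (simp add: exp_add[symmetric])
        also have "\<dots> \<le> (2 * exp (- L / 3)) * exp (- t)"
          using True by (intro mult_right_mono mult_left_mono) auto
        also have "\<dots> \<le> 1 * exp (- t)" using elim by (intro mult_right_mono) auto
        finally show ?thesis using t by (intro Psi_nonpos_of_small) auto
      next
        case False
        have "exp (- L) * exp t \<le> exp (- L) * exp (L + ln L)" using t by simp
        also have "\<dots> = L" using elim by (simp add: exp_add[symmetric])
        finally have "exp (- L) * exp t \<le> L" .
        then have "2 * cgf_poisson_diff (exp (- L)) t \<le> 4 * L + 2 * ln L"
          using cgf_poisson_diff_le[of t "exp (- L)"] t by simp
        also have "\<dots> \<le> (L / 3)\<^sup>2" using elim by simp
        also have "\<dots> \<le> t\<^sup>2" using False elim by (intro power_mono) auto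
        finally show ?thesis using Psi_nonpos_iff[of t "exp (- L)"] t by simp
      qed
    qed
  qed
qed

text \<open>At distance \<open>y\<close> to the left of the centre, \<open>1 / t\<close> gains at
  most \<open>y / L\<^sup>2\<close>, while the subtracted term is at least
  \<open>exp y / (3 * L\<^sup>2)\<close>. The constant 2 exceeds the coefficient, close to 1, that
  is attained at the centre.\<close>

lemma eventually_Psi_far_left:
  "eventually (\<lambda>L. \<forall>t. L + ln L \<le> t \<and> t \<le> argmax_approx L - 6 \<longrightarrow>
     Psi (exp (- L)) t \<le> 1 / argmax_approx L - 2 / L\<^sup>2) at_top"
proof -
  have "eventually (\<lambda>L::real. L \<ge> 1) at_top" "eventually (\<lambda>L. argmax_approx L \<le> 2 * L) at_top"
    unfolding argmax_approx_def by real_asymp+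
  then show ?thesis
  proof eventually_elim
    case (elim L)
    show ?case
    proof (intro allI impI, elim conjE)
      fix t assume t: "L + ln L \<le> t" "t \<le> argmax_approx L - 6"
      define T where "T = argmax_approx L"
      define y where "y = T - t"
      define P where "P = exp (- L) * exp t"
      have y: "y \<ge> 6" using t by (simp add: y_def T_def)
      have L: "L \<ge> 1" "L \<le> t" "t \<le> 2 * L" "L \<le> T" "t = T - y"
        using elim t ln_ge_zero[of L] unfolding T_def y_def by linarith+
      have P: "2 * P = exp (- y) * L ^ 3"
        using exp_argmax_approx[of L "- y"] L by (simp add: P_def T_def)
      have "L = exp (- L) * exp (L + ln L)" using L by (simp add: exp_add[symmetric])
      also have "\<dots> \<le> P" using t by (simp add: P_def)
      finally have "L \<le> P" .
      have "exp y / (3 * L\<^sup>2) = L / (3 * (exp (- y) * L ^ 3))"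
        using L(1) by (simp add: exp_minus field_simps power2_eq_square power3_eq_cube)
      also have "\<dots> = L / (3 * (2 * P))" by (simp only: P)
      also have "\<dots> \<le> t / (3 * (2 * P))" using L \<open>L \<le> P\<close> by (intro divide_right_mono) auto
      \<comment> \<open>Here \<open>t \<le> 2 * L \<le> 2 * P\<close>, hence
        \<open>2 * t + 2 * P \<le> 6 * P\<close>.\<close>
      also have "\<dots> \<le> t / (2 * t + 2 * P)"
        using L \<open>L \<le> P\<close> by (intro divide_left_mono) auto
      finally have 1: "exp y / (3 * L\<^sup>2) \<le> t / (2 * t + 2 * P)" .
      have "1 / t - 1 / T = y / (t * T)" using L by (simp add: field_simps)
      also have "\<dots> \<le> y / (L * L)" using L y by (intro divide_left_mono mult_mono) auto
      finally have 2: "1 / t \<le> 1 / T + y / L\<^sup>2" by (simp add: power2_eq_square)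
      have "exp y / 3 - y \<ge> 2"
      proof -
        \<comment> \<open>The quadratic Taylor bound reduces the claim to
          \<open>y\<^sup>2 - 4 * y - 10 \<ge> 0\<close>, which this factorization implies; hence the
          cutoff 6.\<close>
        have "(y - 6) * (y + 2) \<ge> 0" using y by simp
        then show ?thesis using exp_lower_Taylor_quadratic[of y] y
          by (simp add: power2_eq_square algebra_simps)
      qed
      then have "2 / L\<^sup>2 \<le> (exp y / 3 - y) / L\<^sup>2" using L by (intro divide_right_mono) auto
      also have "\<dots> = exp y / (3 * L\<^sup>2) - y / L\<^sup>2" by (simp add: diff_divide_distrib)
      finally have 3: "2 / L\<^sup>2 \<le> exp y / (3 * L\<^sup>2) - y / L\<^sup>2" .
      have "Psi (exp (- L)) t \<le> 1 / t - t / (2 * t + 2 * P)"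
        using Psi_le[of t "exp (- L)"] L by (simp add: P_def mult.assoc)
      then show "Psi (exp (- L)) t \<le> 1 / argmax_approx L - 2 / L\<^sup>2"
        using 1 2 3 by (simp add: T_def)
    qed
  qed
qed

text \<open>On a bounded window the relative errors are controlled uniformly by expressions free of
  \<open>y\<close>, both tending to 1. The two terms have opposite signs, so the error \<eta> enters
  them in opposite directions.\<close>

lemma eventually_Psi_near_left:
  assumes "\<eta> > 0"
  shows "eventually (\<lambda>L. \<forall>y. 0 \<le> y \<and> y \<le> 6 \<longrightarrow>
     Psi (exp (- L)) (argmax_approx L - y) \<le>
       1 / argmax_approx L - ((1 - \<eta>) * exp y - (1 + \<eta>) * y) / L\<^sup>2) at_top"
proof -
  have "((\<lambda>L. L\<^sup>2 / (argmax_approx L * (argmax_approx L - 6))) \<longlongrightarrow> 1) at_top"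
    "((\<lambda>L. L\<^sup>2 * (argmax_approx L - 6) / (2 * exp 6 * argmax_approx L + L ^ 3)) \<longlongrightarrow> 1) at_top"
    unfolding argmax_approx_def by real_asymp+
  then have "eventually (\<lambda>L. L\<^sup>2 / (argmax_approx L * (argmax_approx L - 6)) < 1 + \<eta>) at_top"
    "eventually (\<lambda>L. L\<^sup>2 * (argmax_approx L - 6) / (2 * exp 6 * argmax_approx L + L ^ 3) > 1 - \<eta>) at_top"
    using assms by (auto elim!: order_tendstoD)
  moreover have "eventually (\<lambda>L::real. L > 0) at_top" "eventually (\<lambda>L. argmax_approx L > 6) at_top"
    unfolding argmax_approx_def by real_asymp+
  ultimately show ?thesis
  proof eventually_elim
    case (elim L)
    show ?case
    proof (intro allI impI, elim conjE)
      fix y :: real assume y: "0 \<le> y" "y \<le> 6"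
      define T where "T = argmax_approx L"
      have L: "L > 0" "T > 6" using elim by (auto simp: T_def)
      have pos: "2 * (T - y) + exp (- y) * L ^ 3 > 0" "2 * exp 6 * T + L ^ 3 > 0"
        using L y by (auto intro!: add_pos_pos)
      have A: "1 / (T * (T - 6)) \<le> (1 + \<eta>) / L\<^sup>2"
        using elim(1) L by (simp add: T_def field_simps)
      have B: "(1 - \<eta>) / L\<^sup>2 \<le> (T - 6) / (2 * exp 6 * T + L ^ 3)"
        using elim(2) L pos by (simp add: T_def[symmetric] divide_simps mult_ac)
      have "1 / (T - y) - 1 / T = y / (T * (T - y))" using L y by (simp add: field_simps)
      also have "\<dots> \<le> y / (T * (T - 6))" using L y by (intro divide_left_mono mult_left_mono) auto
      also have "\<dots> = y * (1 / (T * (T - 6)))" by simp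
      also have "\<dots> \<le> y * ((1 + \<eta>) / L\<^sup>2)" using A y by (intro mult_left_mono) auto
      finally have 1: "1 / (T - y) \<le> 1 / T + y * ((1 + \<eta>) / L\<^sup>2)" by simp
      have "exp y * ((1 - \<eta>) / L\<^sup>2) \<le> exp y * ((T - 6) / (2 * exp 6 * T + L ^ 3))"
        using B by (intro mult_left_mono) auto
      also have "\<dots> = (T - 6) / (exp (- y) * (2 * exp 6 * T + L ^ 3))"
        by (simp add: exp_minus field_simps)
      also have "\<dots> \<le> (T - y) / (exp (- y) * (2 * exp 6 * T + L ^ 3))"
        using y pos by (intro divide_right_mono) auto
      also have "\<dots> \<le> (T - y) / (2 * (T - y) + exp (- y) * L ^ 3)"
      proof (intro divide_left_mono)
        have "2 * (T - y) \<le> 2 * T" using y by simp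
        \<comment> \<open>Inflating by \<open>exp (6 - y) \<ge> 1\<close> lets
          \<open>exp (- y)\<close> factor out of the whole denominator; this is the origin of
          \<open>exp 6\<close> in the limit above.\<close>
        also have "\<dots> \<le> exp (6 - y) * (2 * T)" using y L by simp
        also have "\<dots> = exp (- y) * (2 * exp 6 * T)" by (simp add: exp_diff exp_minus field_simps)
        finally show "2 * (T - y) + exp (- y) * L ^ 3 \<le> exp (- y) * (2 * exp 6 * T + L ^ 3)"
          by (simp add: distrib_left)
      qed (use L y pos in auto)
      finally have 2: "exp y * ((1 - \<eta>) / L\<^sup>2) \<le> (T - y) / (2 * (T - y) + exp (- y) * L ^ 3)" .
      have "Psi (exp (- L)) (T - y) \<le> 1 / (T - y) - (T - y) / (2 * (T - y) + exp (- y) * L ^ 3)"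
        using Psi_le[of "T - y" "exp (- L)"] exp_argmax_approx[of L "- y"] L y by (simp add: T_def)
      also have "\<dots> \<le> 1 / T + y * ((1 + \<eta>) / L\<^sup>2) - exp y * ((1 - \<eta>) / L\<^sup>2)"
        using 1 2 by linarith
      also have "\<dots> = 1 / T - ((1 - \<eta>) * exp y - (1 + \<eta>) * y) / L\<^sup>2"
        by (simp add: diff_divide_distrib add_divide_distrib algebra_simps)
      finally show "Psi (exp (- L)) (argmax_approx L - y) \<le>
          1 / argmax_approx L - ((1 - \<eta>) * exp y - (1 + \<eta>) * y) / L\<^sup>2"
        by (simp add: T_def)
    qed
  qed
qed

text \<open>To the right of the centre both effects lower \<open>Psi\<close>, so a single factor
  \<open>1 - \<eta>\<close> serves for both.\<close>

lemma eventually_Psi_near_right: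
  assumes "\<eta> > 0"
  shows "eventually (\<lambda>L. \<forall>x. 0 \<le> x \<and> x \<le> 2 \<longrightarrow>
     Psi (exp (- L)) (argmax_approx L + x) \<le>
       1 / argmax_approx L - (1 - \<eta>) * (x + exp (- x)) / L\<^sup>2) at_top"
proof -
  have "((\<lambda>L. L\<^sup>2 / (argmax_approx L * (argmax_approx L + 2))) \<longlongrightarrow> 1) at_top"
    "((\<lambda>L. L\<^sup>2 * argmax_approx L / (2 * (argmax_approx L + 2) + L ^ 3)) \<longlongrightarrow> 1) at_top"
    unfolding argmax_approx_def by real_asymp+
  then have "eventually (\<lambda>L. L\<^sup>2 / (argmax_approx L * (argmax_approx L + 2)) > 1 - \<eta>) at_top"
    "eventually (\<lambda>L. L\<^sup>2 * argmax_approx L / (2 * (argmax_approx L + 2) + L ^ 3) > 1 - \<eta>) at_top"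
    using assms by (auto elim!: order_tendstoD)
  moreover have "eventually (\<lambda>L::real. L > 0) at_top" "eventually (\<lambda>L. argmax_approx L > 0) at_top"
    unfolding argmax_approx_def by real_asymp+
  ultimately show ?thesis
  proof eventually_elim
    case (elim L)
    show ?case
    proof (intro allI impI, elim conjE)
      fix x :: real assume x: "0 \<le> x" "x \<le> 2"
      define T where "T = argmax_approx L"
      have L: "L > 0" "T > 0" using elim by (auto simp: T_def)
      have pos: "2 * (T + x) + exp x * L ^ 3 > 0" "2 * (T + 2) + L ^ 3 > 0"
        using L x by (auto intro!: add_pos_pos add_pos_nonneg)
      have A: "(1 - \<eta>) / L\<^sup>2 \<le> 1 / (T * (T + 2))"
        using elim(1) L by (simp add: T_def[symmetric] divide_simps mult_ac)
      have B: "(1 - \<eta>) / L\<^sup>2 \<le> T / (2 * (T + 2) + L ^ 3)"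
        using elim(2) L pos by (simp add: T_def[symmetric] divide_simps mult_ac)
      have "x * ((1 - \<eta>) / L\<^sup>2) \<le> x * (1 / (T * (T + 2)))" using A x by (intro mult_left_mono) auto
      also have "\<dots> = x / (T * (T + 2))" by simp
      also have "\<dots> \<le> x / (T * (T + x))" using L x by (intro divide_left_mono mult_left_mono) auto
      also have "\<dots> = 1 / T - 1 / (T + x)" using L x by (simp add: field_simps)
      finally have 1: "x * ((1 - \<eta>) / L\<^sup>2) \<le> 1 / T - 1 / (T + x)" .
      have "exp (- x) * ((1 - \<eta>) / L\<^sup>2) \<le> exp (- x) * (T / (2 * (T + 2) + L ^ 3))"
        using B by (intro mult_left_mono) auto
      also have "\<dots> = T / (exp x * (2 * (T + 2) + L ^ 3))"
        by (simp add: exp_minus field_simps)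
      also have "\<dots> \<le> (T + x) / (exp x * (2 * (T + 2) + L ^ 3))"
        using x pos by (intro divide_right_mono) auto
      also have "\<dots> \<le> (T + x) / (2 * (T + x) + exp x * L ^ 3)"
      proof (intro divide_left_mono)
        have "2 * (T + x) \<le> 2 * (T + 2)" using x by simp
        also have "\<dots> \<le> exp x * (2 * (T + 2))" using x L by simp
        finally show "2 * (T + x) + exp x * L ^ 3 \<le> exp x * (2 * (T + 2) + L ^ 3)"
          by (simp add: distrib_left)
      qed (use L x pos in auto)
      finally have 2: "exp (- x) * ((1 - \<eta>) / L\<^sup>2) \<le> (T + x) / (2 * (T + x) + exp x * L ^ 3)" .
      have "Psi (exp (- L)) (T + x) \<le> 1 / (T + x) - (T + x) / (2 * (T + x) + exp x * L ^ 3)"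
        using Psi_le[of "T + x" "exp (- L)"] exp_argmax_approx[of L x] L x by (simp add: T_def)
      also have "\<dots> \<le> 1 / T - x * ((1 - \<eta>) / L\<^sup>2) - exp (- x) * ((1 - \<eta>) / L\<^sup>2)"
        using 1 2 by linarith
      also have "\<dots> = 1 / T - (1 - \<eta>) * (x + exp (- x)) / L\<^sup>2"
        by (simp add: add_divide_distrib distrib_left mult.commute)
      finally show "Psi (exp (- L)) (argmax_approx L + x) \<le>
          1 / argmax_approx L - (1 - \<eta>) * (x + exp (- x)) / L\<^sup>2"
        by (simp add: T_def)
    qed
  qed
qed

text \<open>Moving 2 to the right already lowers \<open>1 / t\<close> by about
  \<open>2 / L\<^sup>2\<close>, so \<open>Psi p t < 1 / t\<close> is enough; \<open>3 / 2\<close> is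
  a choice strictly between 1 and 2.\<close>

lemma eventually_Psi_far_right:
  "eventually (\<lambda>L. \<forall>t \<ge> argmax_approx L + 2.
     Psi (exp (- L)) t \<le> 1 / argmax_approx L - (3 / 2) / L\<^sup>2) at_top"
proof -
  have "eventually (\<lambda>L. 1 / (argmax_approx L + 2) \<le> 1 / argmax_approx L - (3 / 2) / L\<^sup>2) at_top"
    "eventually (\<lambda>L. argmax_approx L > 0) at_top"
    unfolding argmax_approx_def by real_asymp+
  then show ?thesis
  proof eventually_elim
    case (elim L)
    show ?case
    proof (intro allI impI)
      fix t assume t: "argmax_approx L + 2 \<le> t"
      have "Psi (exp (- L)) t \<le> 1 / t" using Psi_less[of t "exp (- L)"] t elim by simp
      also have "\<dots> \<le> 1 / (argmax_approx L + 2)" using t elim by (intro divide_left_mono) auto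
      finally show "Psi (exp (- L)) t \<le> 1 / argmax_approx L - (3 / 2) / L\<^sup>2"
        using elim by linarith
    qed
  qed
qed

lemma eventually_Psi_argmax_approx:
  assumes "\<eta> > 0"
  shows "eventually (\<lambda>L. Psi (exp (- L)) (argmax_approx L) \<ge>
           1 / argmax_approx L - (1 + \<eta>) / L\<^sup>2) at_top"
proof -
  have "((\<lambda>L. argmax_approx L / L) \<longlongrightarrow> 1) at_top"
    unfolding argmax_approx_def by real_asymp
  then have "eventually (\<lambda>L. argmax_approx L / L < 1 + \<eta>) at_top"
    using assms by (auto elim!: order_tendstoD)
  moreover have "eventually (\<lambda>L::real. L > 0) at_top" "eventually (\<lambda>L. argmax_approx L > 2) at_top"
    "eventually (\<lambda>L::real. exp (- L) \<le> 1 / 4) at_top"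
    unfolding argmax_approx_def by real_asymp+
  ultimately show ?thesis
  proof eventually_elim
    case (elim L)
    define T where "T = argmax_approx L"
    define p where "p = exp (- L)"
    have T: "T > 2" "p \<le> 1 / 4" "p > 0" "L > 0" using elim by (auto simp: T_def p_def)
    have "p * T \<le> 1 / 4 * T" "p * exp (- T) \<le> 1 * exp (- T)"
      using T by (intro mult_right_mono; simp)+
    \<comment> \<open>The remaining terms sum to at least \<open>T / 2 - 1\<close>, which is
      positive as \<open>T > 2\<close> and \<open>p \<le> 1 / 4\<close>.\<close>
    then have "p * exp T \<le> cgf_poisson_diff p T"
      using T unfolding cgf_poisson_diff_exp distrib_left right_diff_distrib mult.left_commute[of p 2]
      by linarith
    moreover have "2 * (p * exp T) = L ^ 3"
      using exp_argmax_approx[of L 0] T by (simp add: p_def T_def)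
    ultimately have "T / (2 * cgf_poisson_diff p T) \<le> T / L ^ 3"
      using T by (intro divide_left_mono) (auto simp: cgf_poisson_diff_pos)
    also have "\<dots> = (T / L) / L\<^sup>2" by (simp add: power2_eq_square power3_eq_cube)
    also have "\<dots> \<le> (1 + \<eta>) / L\<^sup>2" using elim(1) by (intro divide_right_mono) (auto simp: T_def)
    finally show ?case using Psi_eq[of T p] T by (simp add: T_def p_def)
  qed
qed

text \<open>Away from the centre \<open>x + exp (- x)\<close> exceeds its minimum 1 by a fixed
  amount. The factor \<open>2 * \<delta>\<close> leaves a gap below the value at the centre, which
  costs only \<open>1 + \<delta>\<close>.\<close>

lemma eventually_Psi_away:
  fixes \<epsilon> :: real
  assumes "0 < \<epsilon>"
  obtains \<delta> where "\<delta> > 0"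
    "eventually (\<lambda>L. \<forall>t > 0. \<bar>t - argmax_approx L\<bar> \<ge> \<epsilon> \<longrightarrow>
       Psi (exp (- L)) t \<le> 1 / argmax_approx L - (1 + 2 * \<delta>) / L\<^sup>2) at_top"
proof -
  define m where "m = min (\<epsilon> + exp (- \<epsilon>)) (exp \<epsilon> - \<epsilon>)"
  have m: "m > 1"
    using exp_minus_greater[of \<epsilon>] exp_minus_greater[of "- \<epsilon>"] assms by (auto simp: m_def)
  \<comment> \<open>The cap \<open>1 / 4\<close> gives \<open>1 + 2 * \<delta> \<le> 3 / 2\<close>,
    as the far right range requires; of the margin \<open>3 * \<delta>\<close> below
    \<open>m - 1\<close>, one \<delta> absorbs the errors from \<eta>.\<close>
  define \<delta> where "\<delta> = min (1 / 4) ((m - 1) / 3)"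
  have \<delta>: "\<delta> > 0" "\<delta> \<le> 1 / 4" "1 + 3 * \<delta> \<le> m" using m by (auto simp: \<delta>_def min_def field_simps)
  define \<eta> where "\<eta> = \<delta> / (exp 6 + 6)"
  have \<eta>: "\<eta> > 0" "\<eta> * (exp 6 + 6) = \<delta>"
    using \<delta> add_pos_pos[of "exp 6" "6 :: real"] by (auto simp: \<eta>_def)
  have left: "(1 - \<eta>) * exp y - (1 + \<eta>) * y \<ge> 1 + 2 * \<delta>" if y: "\<epsilon> \<le> y" "y \<le> 6" for y
  proof -
    have "y - \<epsilon> \<le> 1 * (exp (y - \<epsilon>) - 1)" using exp_ge_add_one_self[of "y - \<epsilon>"] unfolding mult_1 by linarith
    also have "\<dots> \<le> exp \<epsilon> * (exp (y - \<epsilon>) - 1)" using y assms by (intro mult_right_mono) auto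
    also have "\<dots> = exp y - exp \<epsilon>" by (simp add: algebra_simps exp_add[symmetric])
    finally have "exp y - y \<ge> m" by (simp add: m_def)
    moreover have "\<eta> * (exp y + y) \<le> \<eta> * (exp 6 + 6)"
      using y \<eta>(1) by (intro mult_left_mono add_mono) auto
    ultimately show ?thesis using \<delta>(3) \<eta>(2) by (simp add: algebra_simps)
  qed
  have right: "(1 - \<eta>) * (x + exp (- x)) \<ge> 1 + 2 * \<delta>" if x: "\<epsilon> \<le> x" "x \<le> 2" for x
  proof -
    have "exp (- \<epsilon>) - exp (- x) = exp (- \<epsilon>) * (1 - exp (\<epsilon> - x))"
      by (simp add: algebra_simps exp_add[symmetric])
    also have "\<dots> \<le> 1 * (1 - exp (\<epsilon> - x))" using x assms by (intro mult_right_mono) auto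
    also have "\<dots> \<le> x - \<epsilon>"
      using exp_ge_add_one_self[of "\<epsilon> - x"] unfolding mult_1 by linarith
    finally have "x + exp (- x) \<ge> m" by (simp add: m_def)
    moreover have "exp (- x) \<le> exp 6" using x assms by simp
    then have "x + exp (- x) \<le> exp 6 + 6" using x by linarith
    then have "\<eta> * (x + exp (- x)) \<le> \<eta> * (exp 6 + 6)"
      using \<eta>(1) by (intro mult_left_mono) auto
    ultimately show ?thesis using \<delta>(3) \<eta>(2) by (simp add: left_diff_distrib)
  qed
  \<comment> \<open>Converts \<open>Psi \<le> 0\<close> on the initial range into the common form of
    bound.\<close>
  have "eventually (\<lambda>L. 1 / argmax_approx L - 2 / L\<^sup>2 \<ge> 0) at_top"
    unfolding argmax_approx_def by real_asymp
  moreover have "eventually (\<lambda>L::real. L > 0) at_top" by real_asymp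
  ultimately have "eventually (\<lambda>L. \<forall>t > 0. \<bar>t - argmax_approx L\<bar> \<ge> \<epsilon> \<longrightarrow>
       Psi (exp (- L)) t \<le> 1 / argmax_approx L - (1 + 2 * \<delta>) / L\<^sup>2) at_top"
    using eventually_Psi_nonpos eventually_Psi_far_left eventually_Psi_near_left[OF \<eta>(1)]
      eventually_Psi_near_right[OF \<eta>(1)] eventually_Psi_far_right
  proof eventually_elim
    case (elim L)
    define T where "T = argmax_approx L"
    have mono: "1 / T - a / L\<^sup>2 \<le> 1 / T - (1 + 2 * \<delta>) / L\<^sup>2" if "1 + 2 * \<delta> \<le> a" for a
      using that by (simp add: divide_right_mono)
    show ?case
    proof (intro allI impI)
      fix t assume t: "t > 0" "\<bar>t - argmax_approx L\<bar> \<ge> \<epsilon>"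
      \<comment> \<open>The ranges may overlap or be empty, for instance when \<epsilon> is large;
        only covering matters.\<close>
      consider "t \<le> L + ln L" | "L + ln L \<le> t" "t \<le> T - 6" | "T - 6 \<le> t" "t \<le> T - \<epsilon>"
        | "T + \<epsilon> \<le> t" "t \<le> T + 2" | "T + 2 \<le> t"
        using t(2) by (fold T_def) linarith
      then show "Psi (exp (- L)) t \<le> 1 / argmax_approx L - (1 + 2 * \<delta>) / L\<^sup>2"
      proof cases
        case 1
        then have "Psi (exp (- L)) t \<le> 1 / T - 2 / L\<^sup>2" using elim(1,3) t by (force simp: T_def)
        also note mono[of 2]
        finally show ?thesis using \<delta> by (simp add: T_def)
      next
        case 2
        then have "Psi (exp (- L)) t \<le> 1 / T - 2 / L\<^sup>2" using elim(4) by (simp add: T_def)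
        also note mono[of 2]
        finally show ?thesis using \<delta> by (simp add: T_def)
      next
        case 3
        then show ?thesis
          using elim(5)[rule_format, of "T - t"] mono[OF left[of "T - t"]] assms
          by (simp add: T_def)
      next
        case 4
        then show ?thesis
          using elim(6)[rule_format, of "t - T"] mono[OF right[of "t - T"]] assms
          by (simp add: T_def)
      next
        case 5
        then have "Psi (exp (- L)) t \<le> 1 / T - (3 / 2) / L\<^sup>2" using elim(7) by (simp add: T_def)
        also note mono[of "3 / 2"]
        finally show ?thesis using \<delta> by (simp add: T_def)
      qed
    qed
  qed
  with \<delta>(1) that show ?thesis by blast
qed

section \<open>Return from large \<open>L\<close> to small \<open>p\<close>, and conclusion\<close>

lemma filterlim_ln_inverse_at_right_0: "filterlim (\<lambda>p::real. ln (1 / p)) at_top (at_right 0)"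
  by real_asymp

text \<open>The substitution \<open>p = exp (- L)\<close>. \<open>R\<close> takes both arguments
  because \<open>Psi\<close> depends on \<open>p\<close> while the bounds are written in
  \<open>L\<close>.\<close>

lemma eventually_at_right_0_via_exp:
  assumes "eventually (\<lambda>L. R (exp (- L)) L) at_top"
  shows "eventually (\<lambda>p::real. R p (ln (1 / p))) (at_right 0)"
proof -
  have "eventually (\<lambda>p::real. p > 0) (at_right 0)" by (simp add: eventually_at_right_less)
  with eventually_compose_filterlim[OF assms filterlim_ln_inverse_at_right_0] show ?thesis
    by eventually_elim (simp add: ln_div)
qed

text \<open>The centre is itself a competitor whose value strictly beats every point at distance at
  least \<epsilon>, so this holds for any choice of maximizers.\<close>

lemma argmax_Psi_tendsto:
  assumes "eventually (\<lambda>p. is_arg_max (Psi p) (\<lambda>s. 0 < s) (t p)) (at_right 0)"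
  shows "((\<lambda>p. t p - argmax_approx (ln (1 / p))) \<longlongrightarrow> 0) (at_right 0)"
proof (rule tendstoI)
  fix \<epsilon> :: real assume "\<epsilon> > 0"
  then obtain \<delta> where \<delta>: "\<delta> > 0"
    "eventually (\<lambda>L. \<forall>t > 0. \<bar>t - argmax_approx L\<bar> \<ge> \<epsilon> \<longrightarrow>
       Psi (exp (- L)) t \<le> 1 / argmax_approx L - (1 + 2 * \<delta>) / L\<^sup>2) at_top"
    by (rule eventually_Psi_away)
  have "eventually (\<lambda>L. argmax_approx L > 0) at_top" "eventually (\<lambda>L::real. L > 0) at_top"
    unfolding argmax_approx_def by real_asymp+
  with \<delta>(2) eventually_Psi_argmax_approx[OF \<delta>(1)]
  have "eventually (\<lambda>L. \<forall>s > 0. \<bar>s - argmax_approx L\<bar> \<ge> \<epsilon> \<longrightarrow>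
      argmax_approx L > 0 \<and> Psi (exp (- L)) s < Psi (exp (- L)) (argmax_approx L)) at_top"
  proof eventually_elim
    case (elim L)
    have "(1 + \<delta>) / L\<^sup>2 < (1 + 2 * \<delta>) / L\<^sup>2"
      using elim(4) \<delta>(1) by (intro divide_strict_right_mono) auto
    with elim show ?case by force
  qed
  from eventually_at_right_0_via_exp[where R = "\<lambda>p L. \<forall>s > 0. \<bar>s - argmax_approx L\<bar> \<ge> \<epsilon> \<longrightarrow>
      argmax_approx L > 0 \<and> Psi p s < Psi p (argmax_approx L)", OF this] assms
  show "eventually (\<lambda>p. dist (t p - argmax_approx (ln (1 / p))) 0 < \<epsilon>) (at_right 0)"
  proof eventually_elim
    case (elim p)
    then have "t p > 0" "\<not> Psi p (t p) < Psi p s" if "s > 0" for s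
      using that by (auto simp: is_arg_max_def)
    \<comment> \<open>The premise \<open>s > 0\<close> also guards the fact \<open>t p > 0\<close>;
      \<open>zero_less_one\<close> discharges it there.\<close>
    with elim(1) have "\<not> \<bar>t p - argmax_approx (ln (1 / p))\<bar> \<ge> \<epsilon>"
      using zero_less_one by blast
    then show ?case by (simp add: dist_real_def)
  qed
qed

text \<open>Two-sided control of the supremum of \<open>Psi\<close>, coarse but with both bounds
  asymptotic to \<open>1 / L\<close>. Within distance 1 of the centre \<open>1 / t\<close> is at
  most \<open>1 / (T - 1)\<close>; elsewhere \<open>Psi\<close> stays below
  \<open>1 / T\<close>.\<close>

lemma eventually_Psi_bounds:
  "eventually (\<lambda>p. \<exists>s > 0. 1 / argmax_approx (ln (1 / p)) - 2 / (ln (1 / p))\<^sup>2 \<le> Psi p s) (at_right 0)"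
  "eventually (\<lambda>p. 0 \<le> 1 / (argmax_approx (ln (1 / p)) - 1) \<and>
     (\<forall>t > 0. Psi p t \<le> 1 / (argmax_approx (ln (1 / p)) - 1))) (at_right 0)"
proof -
  have T: "eventually (\<lambda>L. argmax_approx L > 1) at_top"
    unfolding argmax_approx_def by real_asymp
  have "eventually (\<lambda>L. \<exists>s > 0. 1 / argmax_approx L - 2 / L\<^sup>2 \<le> Psi (exp (- L)) s) at_top"
    using T eventually_Psi_argmax_approx[OF zero_less_one]
  proof eventually_elim
    case (elim L)
    then show ?case by (intro exI[of _ "argmax_approx L"]) auto
  qed
  from eventually_at_right_0_via_exp[where R = "\<lambda>p L. \<exists>s > 0. 1 / argmax_approx L - 2 / L\<^sup>2 \<le> Psi p s", OF this]
  show "eventually (\<lambda>p. \<exists>s > 0. 1 / argmax_approx (ln (1 / p)) - 2 / (ln (1 / p))\<^sup>2 \<le> Psi p s)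
    (at_right 0)" .
  obtain \<delta> where \<delta>: "\<delta> > 0"
    "eventually (\<lambda>L. \<forall>t > 0. \<bar>t - argmax_approx L\<bar> \<ge> 1 \<longrightarrow>
       Psi (exp (- L)) t \<le> 1 / argmax_approx L - (1 + 2 * \<delta>) / L\<^sup>2) at_top"
    using eventually_Psi_away[OF zero_less_one] by blast
  have "eventually (\<lambda>L. 0 \<le> 1 / (argmax_approx L - 1) \<and>
     (\<forall>t > 0. Psi (exp (- L)) t \<le> 1 / (argmax_approx L - 1))) at_top"
    using T \<delta>(2)
  proof eventually_elim
    case (elim L)
    define T where "T = argmax_approx L"
    have "Psi (exp (- L)) t \<le> 1 / (T - 1)" if "t > 0" for t
    proof (cases "\<bar>t - T\<bar> \<ge> 1")
      case True
      then have "Psi (exp (- L)) t \<le> 1 / T - (1 + 2 * \<delta>) / L\<^sup>2" using elim that by (simp add: T_def)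
      also have "\<dots> \<le> 1 / T" using \<delta>(1) by simp
      also have "\<dots> \<le> 1 / (T - 1)" using elim by (intro divide_left_mono) (auto simp: T_def)
      finally show ?thesis .
    next
      case False
      have "Psi (exp (- L)) t \<le> 1 / t" using Psi_less[of t "exp (- L)"] that by simp
      also have "\<dots> \<le> 1 / (T - 1)"
        using False elim that by (intro divide_left_mono) (auto simp: T_def)
      finally show ?thesis .
    qed
    with elim(1) show ?case by (simp add: T_def)
  qed
  from eventually_at_right_0_via_exp[where R = "\<lambda>p L. 0 \<le> 1 / (argmax_approx L - 1) \<and>
     (\<forall>t > 0. Psi p t \<le> 1 / (argmax_approx L - 1))", OF this]
  show "eventually (\<lambda>p. 0 \<le> 1 / (argmax_approx (ln (1 / p)) - 1) \<and>
     (\<forall>t > 0. Psi p t \<le> 1 / (argmax_approx (ln (1 / p)) - 1))) (at_right 0)" .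
qed

theorem theorem7p1:
  fixes lam :: real
    and M :: "real \<Rightarrow> 'a measure"
    and Nplus Nminus :: "real \<Rightarrow> 'a \<Rightarrow> nat"
    and X :: "real \<Rightarrow> 'a \<Rightarrow> real"
  assumes "lam > 0"
    and "\<And>p. 0 < p \<Longrightarrow> p < (2 + sqrt 3) / 4 \<Longrightarrow> prob_space (M p)"
    and "\<And>p. 0 < p \<Longrightarrow> p < (2 + sqrt 3) / 4 \<Longrightarrow>
           prob_space.indep_var (M p) (count_space UNIV) (Nplus p) (count_space UNIV) (Nminus p)"
    and "\<And>p. 0 < p \<Longrightarrow> p < (2 + sqrt 3) / 4 \<Longrightarrow>
           distr (M p) (count_space UNIV) (Nplus p) = measure_pmf (poisson_pmf (lam * p))"
    and "\<And>p. 0 < p \<Longrightarrow> p < (2 + sqrt 3) / 4 \<Longrightarrow>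
           distr (M p) (count_space UNIV) (Nminus p) = measure_pmf (poisson_pmf (lam * (1 - p)))"
    and "\<And>p \<omega>. 0 < p \<Longrightarrow> p < (2 + sqrt 3) / 4 \<Longrightarrow>
           X p \<omega> = real (Nplus p \<omega>) - real (Nminus p \<omega>) - lam * (2 * p - 1)"
  shows "(\<forall>t :: real \<Rightarrow> real.
            (\<forall>p. 0 < p \<and> p < (2 + sqrt 3) / 4 \<longrightarrow> is_arg_max (Psi p) (\<lambda>s. 0 < s) (t p)) \<longrightarrow>
            (\<lambda>p. t p - (ln (1 / p) + 3 * ln (ln (1 / p)) - ln 2)) \<in> o[at_right 0](\<lambda>_. 1)) \<and>
         (\<lambda>p. real_of_ereal (c_plus (M p) (X p))) \<sim>[at_right 0] (\<lambda>p. 1 / ln (1 / p))"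
proof -
  have range: "eventually (\<lambda>p::real. 0 < p \<and> p < (2 + sqrt 3) / 4) (at_right 0)"
    unfolding eventually_at_right_field
    by (intro exI[of _ "(2 + sqrt 3) / 4"]) (auto intro: add_pos_nonneg)
  \<comment> \<open>As \<open>sqrt 3 < sqrt 4 = 2\<close>, the admissible range lies below 1 and
    both Poisson rates are positive.\<close>
  have lt1: "p < 1" if "p < (2 + sqrt 3) / 4" for p :: real
    using that real_sqrt_less_iff[of 3 4] by simp
  have bounds: "eventually (\<lambda>p. real_of_ereal (c_plus (M p) (X p)) \<in>
      {1 / argmax_approx (ln (1 / p)) - 2 / (ln (1 / p))\<^sup>2 .. 1 / (argmax_approx (ln (1 / p)) - 1)})
      (at_right 0)"
    using range eventually_Psi_bounds
  proof eventually_elim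
    case (elim p)
    then have p: "0 < p" "p < (2 + sqrt 3) / 4" "p < 1" using lt1 by auto
    note compensated = assms(2)[OF p(1,2)] assms(1) p(1,3) assms(3-6)[OF p(1,2)]
    obtain s where "s > 0" "1 / argmax_approx (ln (1 / p)) - 2 / (ln (1 / p))\<^sup>2 \<le> Psi p s"
      using elim by blast
    then show ?case
      using real_of_ereal_c_plus_bounds[OF assms(1) p(1)
          cgf_compensated_poisson_diff[OF compensated] variance_compensated_poisson_diff[OF compensated],
          of s "1 / (argmax_approx (ln (1 / p)) - 1)"] elim
      by auto
  qed
  \<comment> \<open>The centre is asymptotic to \<open>L\<close>, and \<open>2 / L\<^sup>2\<close>
    is negligible against \<open>1 / L\<close>.\<close>
  have "(\<lambda>p. 1 / argmax_approx (ln (1 / p)) - 2 / (ln (1 / p))\<^sup>2) \<sim>[at_right 0] (\<lambda>p. 1 / ln (1 / p))"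
    "(\<lambda>p. 1 / (argmax_approx (ln (1 / p)) - 1)) \<sim>[at_right 0] (\<lambda>p. 1 / ln (1 / p))"
    unfolding argmax_approx_def by real_asymp+
  note c_plus = asymp_equiv_sandwich_real[OF this bounds]
  show ?thesis
  proof (intro conjI allI impI c_plus)
    fix t :: "real \<Rightarrow> real"
    assume t: "\<forall>p. 0 < p \<and> p < (2 + sqrt 3) / 4 \<longrightarrow> is_arg_max (Psi p) (\<lambda>s. 0 < s) (t p)"
    have "((\<lambda>p. t p - argmax_approx (ln (1 / p))) \<longlongrightarrow> 0) (at_right 0)"
      using range by (intro argmax_Psi_tendsto) (auto elim!: eventually_mono simp: t)
    then show "(\<lambda>p. t p - (ln (1 / p) + 3 * ln (ln (1 / p)) - ln 2)) \<in> o[at_right 0](\<lambda>_. 1)"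
      by (intro smalloI_tendsto) (simp_all add: argmax_approx_def)
  qed
qed

end
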